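(* Fix $\tau\in\mathbb H$, let $m\in-\frac12\mathbb N$ (i.e. $m\in\{-\frac12,-1,-\frac32,\dots\}$) and $\varepsilon\in\{0,1\}$. Let $\phi:\mathbb C\to\mathbb C$ be a meromorphic function satisfying, for all $\lambda,\mu\in\mathbb Z$ and all $z$, \[\phi(z+\lambda\tau+\mu)=(-1)^{2m\mu+\lambda\varepsilon}e^{-2\pi i m(\lambda^2\tau+2\lambda z)}\phi(z).\] Let $z_0\in\mathbb C$ be such that $\phi$ has no poles on the boundary $\partial P_{z_0}$. Then for every $z\in\mathbb C$ at which $\phi$ is holomorphic, \[\phi(z)=-\sum_{u\in s_{z_0,\tau}}\sum_{n\in\mathbb N}\frac{D_{n,u}}{(n-1)!}\,\mathcal D_v^{\,n-1}\bigl(F_{-m,\varepsilon}(z,v)\bigr)\Big|_{v=u}.\] (Only finitely many terms in the double sum are nonzero.)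
   Context: Notation: $e(x):=e^{2\pi i x}$, $q:=e(\tau)$, and for a variable $x$, $\mathcal D_x:=\frac{1}{2\pi i}\frac{\partial}{\partial x}$. For $z_0\in\mathbb C$, $P_{z_0}:=z_0+[0,1)\tau+[0,1)$ is a fundamental parallelogram for the lattice $\mathbb Z\tau+\mathbb Z$, and $s_{z_0,\tau}$ denotes the (finite) set of poles of $\phi$ lying in $P_{z_0}$. For a pole $u$ of $\phi$, the Laurent coefficients $D_{n,u}$ ($n\ge1$) are defined by $\phi(z)=\sum_{n\ge1}\frac{D_{n,u}}{(2\pi i(z-u))^n}+O(1)$ as $z\to u$ (only finitely many $D_{n,u}$ nonzero). For $M\in\frac12\mathbb N$, the Appell--Lerch sum is \[F_{M,\varepsilon}(z,u)=F_{M,\varepsilon}(z,u;\tau):=e\bigl(M(z-u)\bigr)\sum_{n\in\mathbb Z}\frac{(-1)^{n\varepsilon}e(-2Mnu)\,q^{Mn(n+1)}}{1-q^n e(z-u)}.\] *)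

theory Defs
  imports "HOL-Analysis.Analysis"
begin

definition ee :: "complex \<Rightarrow> complex" where
  "ee x = exp (2 * pi * \<i> * x)"

definition Dnorm_iter :: "nat \<Rightarrow> (complex \<Rightarrow> complex) \<Rightarrow> complex \<Rightarrow> complex" where
  "Dnorm_iter j f x = (1 / (2 * pi * \<i>)) ^ j * (deriv ^^ j) f x"

definition fund_par :: "complex \<Rightarrow> complex \<Rightarrow> complex set" where
  "fund_par z0 \<tau> = {z0 + of_real a * \<tau> + of_real b | a b. 0 \<le> a \<and> a < 1 \<and> 0 \<le> b \<and> b < 1}"

definition principal_part :: "(complex \<Rightarrow> complex) \<Rightarrow> complex \<Rightarrow> nat \<Rightarrow> (nat \<Rightarrow> complex) \<Rightarrow> bool" where
  "principal_part \<phi> u N D \<longleftrightarrow> D 0 = 0 \<and> (\<forall>n>N. D n = 0) \<and>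
     (\<exists>g r. r > 0 \<and> g holomorphic_on ball u r \<and>
        (\<forall>z\<in>ball u r - {u}. \<phi> z = (\<Sum>n=1..N. D n / (2 * pi * \<i> * (z - u)) ^ n) + g z))"

definition is_pole :: "(complex \<Rightarrow> complex) \<Rightarrow> complex \<Rightarrow> bool" where
  "is_pole \<phi> u \<longleftrightarrow> (\<exists>N D. principal_part \<phi> u N D \<and> (\<exists>n. D n \<noteq> 0))"

text \<open>Laurent coefficients D_{n,u} (unique when u is a pole).\<close>
definition laurent_coeff :: "(complex \<Rightarrow> complex) \<Rightarrow> complex \<Rightarrow> nat \<Rightarrow> complex" where
  "laurent_coeff \<phi> u = (SOME D. \<exists>N. principal_part \<phi> u N D)"

text \<open>phi is meromorphic on C with pole set P: P is closed and discrete, phi is holomorphic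
  off P, and every point of P is a genuine pole (values of phi on P are irrelevant).\<close>
definition meromorphic_with_poles :: "(complex \<Rightarrow> complex) \<Rightarrow> complex set \<Rightarrow> bool" where
  "meromorphic_with_poles \<phi> P \<longleftrightarrow>
     (\<forall>z. \<exists>e>0. \<forall>w\<in>ball z e. w \<in> P \<longrightarrow> w = z) \<and>
     \<phi> holomorphic_on (- P) \<and> (\<forall>u\<in>P. is_pole \<phi> u)"

text \<open>Appell--Lerch sum F_{M,eps}(z,u;tau); q^{M n(n+1)} = e(M n (n+1) tau).\<close>
definition appell_lerch :: "real \<Rightarrow> int \<Rightarrow> complex \<Rightarrow> complex \<Rightarrow> complex \<Rightarrow> complex" where
  "appell_lerch M \<epsilon> z u \<tau> = ee (of_real M * (z - u)) *
     (\<Sum>\<^sub>\<infinity>n::int. (-1) powi (n * \<epsilon>) * ee (- 2 * of_real M * of_int n * u)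
        * ee (of_real M * of_int n * of_int (n + 1) * \<tau>)
        / (1 - ee (of_int n * \<tau>) * ee (z - u)))"

end

theory Submission
  imports Defs "HOL-Complex_Analysis.Complex_Analysis"
begin

text \<open>As a function of \<open>v\<close>, the Appell--Lerch sum \<open>F(z, v)\<close> has the inverse of the multipliers of \<open>\<phi>\<close>, so
  \<open>h(v) = \<phi>(v) F(z, v)\<close> is elliptic, and its residues sum to zero over any fundamental domain. The poles
  are those of \<open>\<phi>\<close> and the points of \<open>z + \<int>\<tau> + \<int>\<close>, which contribute the single residue
  \<open>\<phi>(z) / (2\<pi>\<i>)\<close>; at a pole \<open>u\<close> of \<open>\<phi>\<close> the residue is read off from the principal part of \<open>\<phi>\<close> and the
  Taylor expansion of \<open>F(z, v)\<close> at \<open>v = u\<close>.\<close>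

subsection \<open>Residues of elliptic functions\<close>

text \<open>The sign of \<open>m\<close> is what makes the kernel exist: for
  \<open>M = - m > 0\<close> the factor \<open>ee (M * n * (n + 1) * \<tau>)\<close> has Gaussian
  decay in \<open>n\<close>, which beats the growth of the other factors for every \<open>v\<close>.
  The singularity at \<open>v = z\<close> comes from the single summand \<open>n = 0\<close>, whose
  denominator \<open>1 - ee (z - v)\<close> vanishes there with derivative
  \<open>2 * pi * \<i>\<close>. At a pole of \<phi> the same factor is left over, since
  \<open>n\<close> powers of \<open>2 * pi * \<i>\<close> meet a normalised derivative of order
  \<open>n - 1\<close>; so it cancels from the final identity. Two obstacles shape the rest. The
  transformation law is given only off \<open>P\<close>, so the invariance of \<open>P\<close> under
  the lattice has to be derived from the poles being genuine. And a frontier that avoids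
  \<open>P\<close> may still pass through points congruent to \<open>z\<close>, so the sum over the
  half-open parallelogram is transferred from a domain whose sides avoid every singularity.\<close>

lemma integral_periodic_shift_nonneg:
  fixes F :: "real \<Rightarrow> complex"
  assumes cont: "continuous_on UNIV F" and per: "\<And>x. F (x + 1) = F x" and "s \<ge> 0"
  shows "integral {0..1} (\<lambda>x. F (x + s)) = integral {0..1} F"
proof -
  have int: "F integrable_on {a..b}" for a b
    by (intro integrable_continuous_real continuous_on_subset[OF cont]) auto
  have shift: "integral {a..b} (\<lambda>x. F (x + c)) = integral {a+c..b+c} F" for a b c
    using integral_shift_Icc_real[of a b F c] by (simp add: o_def add.commute)
  \<comment> \<open>Cut \<open>{0..s+1}\<close> once at \<open>s\<close> and once at
    \<open>1\<close>; the surplus pieces \<open>{0..s}\<close> and \<open>{1..s+1}\<close> differ by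
    the period.\<close>
  have "integral {0..s} F + integral {s..s+1} F = integral {0..s+1} F"
    by (rule Henstock_Kurzweil_Integration.integral_combine) (use \<open>s \<ge> 0\<close> int in auto)
  also have "\<dots> = integral {0..1} F + integral {1..s+1} F"
    by (rule Henstock_Kurzweil_Integration.integral_combine [symmetric]) (use \<open>s \<ge> 0\<close> int in auto)
  also have "integral {1..s+1} F = integral {0..s} F"
    using shift[of 0 s 1] by (simp add: per)
  finally show ?thesis
    using shift[of 0 1 s] by (simp add: add.commute)
qed

lemma integral_periodic_shift:
  fixes F :: "real \<Rightarrow> complex"
  assumes cont: "continuous_on UNIV F" and per: "\<And>x. F (x + 1) = F x"
  shows "integral {0..1} (\<lambda>x. F (x + s)) = integral {0..1} F"
proof (cases "s \<ge> 0")
  case True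
  then show ?thesis using integral_periodic_shift_nonneg assms by blast
next
  case False
  have "continuous_on UNIV (\<lambda>x. F (x + s))"
    by (rule continuous_on_compose2[OF cont]) (auto intro!: continuous_intros)
  moreover have "F (x + 1 + s) = F (x + s)" for x
    using per[of "x + s"] by (simp add: add_ac)
  ultimately have "integral {0..1} (\<lambda>x. F (x + -s + s)) = integral {0..1} (\<lambda>x. F (x + s))"
    using False by (intro integral_periodic_shift_nonneg[of "\<lambda>x. F (x + s)" "-s"]) auto
  then show ?thesis by simp
qed

text \<open>The vertical sides differ by the period \<open>1\<close> and cancel. The top side is the
  bottom one moved by \<open>\<i> * Im \<tau> = \<tau> - Re \<tau>\<close>: the period \<tau> drops
  out, and what remains is a real shift of an integral over a full period. That shift runs past the
  ends of the bottom side, whence continuity on its whole line.\<close>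

lemma doubly_periodic_contour_integral_rectpath:
  fixes h :: "complex \<Rightarrow> complex"
  assumes cont: "continuous_on {w. Im w = Im a} h" "continuous_on {w. Im w = Im a + Im \<tau>} h"
      "continuous_on {w. Re w = Re a} h" "continuous_on {w. Re w = Re a + 1} h"
    and per1: "\<And>w. h (w + 1) = h w" and per2: "\<And>w. h (w + \<tau>) = h w"
  shows "contour_integral (rectpath a (a + 1 + \<i> * Im \<tau>)) h = 0"
proof -
  define b where "b = a + \<i> * Im \<tau>"
  have corners: "Complex (Re (a + 1 + \<i> * Im \<tau>)) (Im a) = a + 1"
      "Complex (Re a) (Im (a + 1 + \<i> * Im \<tau>)) = b" "a + 1 + \<i> * Im \<tau> = b + 1"
    by (simp_all add: complex_eq_iff b_def)
  have int: "h contour_integrable_on linepath a (a + 1)"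
    "h contour_integrable_on linepath (a + 1) (b + 1)"
    "h contour_integrable_on linepath (b + 1) b"
    "h contour_integrable_on linepath b a"
    using cont(1,4,2,3)[THEN continuous_on_subset, THEN contour_integrable_continuous_linepath]
    by (simp_all add: closed_segment_same_Im closed_segment_same_Re b_def Collect_mono)
  have line: "contour_integral (linepath c (c + 1)) h = integral {0..1} (\<lambda>x. h (c + of_real x))" for c
    by (simp add: contour_integral_integral linepath_def scaleR_conv_of_real algebra_simps)
  have "contour_integral (linepath b (b + 1)) h = integral {0..1} (\<lambda>x. h (a + of_real (x - Re \<tau>)))"
    unfolding line
  proof (rule arg_cong[of _ _ "integral {0..1}"], rule ext)
    fix x :: real
    have "b + of_real x = a + of_real (x - Re \<tau>) + \<tau>"
      by (simp add: complex_eq_iff b_def)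
    then show "h (b + of_real x) = h (a + of_real (x - Re \<tau>))"
      by (simp only: per2)
  qed
  also have "\<dots> = integral {0..1} (\<lambda>x. h (a + of_real x))"
  proof -
    have "continuous_on UNIV (\<lambda>x. h (a + of_real x))"
      by (rule continuous_on_compose2[OF cont(1)]) (auto intro!: continuous_intros)
    moreover have "h (a + of_real (x + 1)) = h (a + of_real x)" for x
      using per1[of "a + of_real x"] by (simp add: add_ac)
    ultimately show ?thesis
      using integral_periodic_shift[of "\<lambda>x. h (a + of_real x)" "- Re \<tau>"] by simp
  qed
  finally have horizontal:
    "contour_integral (linepath b (b + 1)) h = contour_integral (linepath a (a + 1)) h"
    by (simp add: line)
  have "linepath (a + 1) (b + 1) = (+) 1 \<circ> linepath a b"
    by (simp add: linepath_translate)
  then have vertical: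
    "contour_integral (linepath (a + 1) (b + 1)) h = contour_integral (linepath a b) h"
    by (simp only: contour_integral_translate per1)
  have rev: "contour_integral (linepath (b + 1) b) h = - contour_integral (linepath b (b + 1)) h"
      "contour_integral (linepath b a) h = - contour_integral (linepath a b) h"
    using contour_integral_reversepath[of "linepath b (b + 1)" h]
      contour_integral_reversepath[of "linepath a b" h] by simp_all
  have "rectpath a (a + 1 + \<i> * Im \<tau>) = linepath a (a + 1) +++ linepath (a + 1) (b + 1) +++
      linepath (b + 1) b +++ linepath b a"
    unfolding rectpath_def Let_def corners(1,2) by (simp only: corners(3))
  then show ?thesis
    using int horizontal vertical rev
    by (simp add: contour_integrable_joinI valid_path_join)
qed

lemma exists_real_avoiding_countable:
  assumes "countable (A :: real set)"
  obtains x where "x \<notin> A"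
  using assms uncountable_UNIV_real by (metis UNIV_eq_I)

section \<open>The period lattice and its systems of representatives\<close>

definition period_lattice :: "complex \<Rightarrow> complex set" where
  "period_lattice \<tau> = {of_int l * \<tau> + of_int j | l j. True}"

text \<open>Purely combinatorial, with no topology: half-open parallelograms and half-open
  rectangles qualify alike and become interchangeable.\<close>

definition fundamental_domain :: "complex set \<Rightarrow> complex set \<Rightarrow> bool" where
  "fundamental_domain L T \<longleftrightarrow> (\<forall>w. \<exists>!t. t \<in> T \<and> t - w \<in> L)"

lemma period_lattice_uminus: "x \<in> period_lattice \<tau> \<Longrightarrow> - x \<in> period_lattice \<tau>"
  unfolding period_lattice_def
  by (clarsimp, rule_tac x = "-l" in exI, rule_tac x = "-j" in exI) simp

lemma period_lattice_add:
  "x \<in> period_lattice \<tau> \<Longrightarrow> y \<in> period_lattice \<tau> \<Longrightarrow> x + y \<in> period_lattice \<tau>"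
  unfolding period_lattice_def
  by (clarsimp, rule_tac x = "l + la" in exI, rule_tac x = "j + ja" in exI) (simp add: algebra_simps)

lemma period_lattice_diff:
  "x \<in> period_lattice \<tau> \<Longrightarrow> y \<in> period_lattice \<tau> \<Longrightarrow> x - y \<in> period_lattice \<tau>"
  using period_lattice_add period_lattice_uminus by fastforce

lemma period_lattice_generators: "1 \<in> period_lattice \<tau>" "\<tau> \<in> period_lattice \<tau>"
  unfolding period_lattice_def
   apply (clarsimp, rule exI[of _ 0], rule exI[of _ 1], simp)
  apply (clarsimp, rule exI[of _ 1], rule exI[of _ 0], simp)
  done

text \<open>Sending a point to its representative in the other domain is a bijection between
  \<open>S \<inter> A\<close> and \<open>S \<inter> B\<close>: going back and forth returns to the
  start because representatives are unique. It preserves \<open>R\<close> because points are moved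
  only by elements of \<open>L\<close>.\<close>

lemma sum_over_fundamental_domains:
  assumes A: "fundamental_domain L A" and B: "fundamental_domain L B"
    and uminus: "\<And>x. x \<in> L \<Longrightarrow> - x \<in> L"
    and S: "\<And>w x. x \<in> L \<Longrightarrow> w \<in> S \<Longrightarrow> w + x \<in> S"
    and R: "\<And>w x. x \<in> L \<Longrightarrow> w \<in> S \<Longrightarrow> R (w + x) = R w"
  shows "sum R (S \<inter> A) = sum R (S \<inter> B)"
proof -
  obtain f where f: "\<And>w. f w \<in> A \<and> f w - w \<in> L" "\<And>w t. t \<in> A \<Longrightarrow> t - w \<in> L \<Longrightarrow> t = f w"
    using A unfolding fundamental_domain_def by metis
  obtain g where g: "\<And>w. g w \<in> B \<and> g w - w \<in> L" "\<And>w t. t \<in> B \<Longrightarrow> t - w \<in> L \<Longrightarrow> t = g w"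
    using B unfolding fundamental_domain_def by metis
  have diff: "x - y \<in> L" if "y - x \<in> L" for x y
    using uminus[OF that] by simp
  show ?thesis
  proof (rule sum.reindex_bij_witness[of _ f g])
    show "f (g w) = w" if "w \<in> S \<inter> A" for w
      using f(2)[of w "g w"] g(1)[of w] that diff by auto
    show "g (f w) = w" if "w \<in> S \<inter> B" for w
      using g(2)[of w "f w"] f(1)[of w] that diff by auto
    show "g w \<in> S \<inter> B" if "w \<in> S \<inter> A" for w
      using S[of "g w - w" w] g(1)[of w] that by auto
    show "f w \<in> S \<inter> A" if "w \<in> S \<inter> B" for w
      using S[of "f w - w" w] f(1)[of w] that by auto
    show "R (g w) = R w" if "w \<in> S \<inter> A" for w
      using R[of "g w - w" w] g(1)[of w] that by auto
  qed
qed

lemma floor_shift_unique: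
  fixes x c :: real
  shows "c \<le> x + of_int j \<and> x + of_int j < c + 1 \<longleftrightarrow> j = - \<lfloor>x - c\<rfloor>"
  by linarith

lemma fundamental_domain_fund_par:
  assumes "Im \<tau> > 0"
  shows "fundamental_domain (period_lattice \<tau>) (fund_par z0 \<tau>)"
  unfolding fundamental_domain_def
proof
  fix w
  \<comment> \<open>\<open>a\<close> and \<open>b\<close> are the real coordinates of
    \<open>w - z0\<close> in the basis \<tau>, 1; the representative keeps their fractional
    parts.\<close>
  define a where "a = Im (w - z0) / Im \<tau>"
  define b where "b = Re (w - z0) - a * Re \<tau>"
  have w: "w = z0 + of_real a * \<tau> + of_real b"
    using assms by (simp add: complex_eq_iff a_def b_def)
  have unique: "x = y \<and> x' = y'"
    if "of_real x * \<tau> + of_real x' = of_real y * \<tau> + of_real y'" for x y x' y'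
    using that assms by (auto simp: complex_eq_iff)
  have iff: "t \<in> fund_par z0 \<tau> \<and> t - w \<in> period_lattice \<tau> \<longleftrightarrow>
      t = z0 + of_real (a - of_int \<lfloor>a\<rfloor>) * \<tau> + of_real (b - of_int \<lfloor>b\<rfloor>)" for t
  proof
    assume "t \<in> fund_par z0 \<tau> \<and> t - w \<in> period_lattice \<tau>"
    then obtain c d l j where t: "t = z0 + of_real c * \<tau> + of_real d" "0 \<le> c" "c < 1" "0 \<le> d" "d < 1"
      and lj: "t - w = of_int l * \<tau> + of_int j"
      unfolding fund_par_def period_lattice_def by blast
    have "of_real c * \<tau> + of_real d = of_real (a + of_int l) * \<tau> + of_real (b + of_int j)"
      using t(1) lj w by (simp add: algebra_simps)
    then have cd: "c = a + of_int l" "d = b + of_int j" using unique by blast+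
    then have "l = - \<lfloor>a\<rfloor>" "j = - \<lfloor>b\<rfloor>" using t by linarith+
    then show "t = z0 + of_real (a - of_int \<lfloor>a\<rfloor>) * \<tau> + of_real (b - of_int \<lfloor>b\<rfloor>)"
      using t(1) cd by simp
  next
    assume t: "t = z0 + of_real (a - of_int \<lfloor>a\<rfloor>) * \<tau> + of_real (b - of_int \<lfloor>b\<rfloor>)"
    have "t \<in> fund_par z0 \<tau>"
      unfolding fund_par_def t
      by (intro CollectI exI[of _ "a - of_int \<lfloor>a\<rfloor>"] exI[of _ "b - of_int \<lfloor>b\<rfloor>"] conjI refl) linarith+
    moreover have "t - w = of_int (- \<lfloor>a\<rfloor>) * \<tau> + of_int (- \<lfloor>b\<rfloor>)"
      using t w by (simp add: algebra_simps)
    ultimately show "t \<in> fund_par z0 \<tau> \<and> t - w \<in> period_lattice \<tau>"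
      unfolding period_lattice_def by blast
  qed
  show "\<exists>!t. t \<in> fund_par z0 \<tau> \<and> t - w \<in> period_lattice \<tau>"
    unfolding iff by blast
qed

lemma fundamental_domain_rectangle:
  assumes "Im \<tau> > 0"
  shows "fundamental_domain (period_lattice \<tau>)
    {w. a \<le> Re w \<and> Re w < a + 1 \<and> b \<le> Im w \<and> Im w < b + Im \<tau>}"
  unfolding fundamental_domain_def
proof
  fix w
  \<comment> \<open>The imaginary part alone determines the multiple of \<tau>. Only then is
    \<open>j\<close> determined, by the real part after the drift
    \<open>l * Re \<tau>\<close>.\<close>
  define l where "l = - \<lfloor>(Im w - b) / Im \<tau>\<rfloor>"
  define j where "j = - \<lfloor>Re w + of_int l * Re \<tau> - a\<rfloor>"
  have l_iff: "b \<le> Im w + of_int i * Im \<tau> \<and> Im w + of_int i * Im \<tau> < b + Im \<tau> \<longleftrightarrow> i = l" for i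
  proof -
    have "b \<le> Im w + of_int i * Im \<tau> \<longleftrightarrow> 0 \<le> (Im w - b) / Im \<tau> + of_int i"
      using assms by (simp add: field_simps)
    moreover have "Im w + of_int i * Im \<tau> < b + Im \<tau> \<longleftrightarrow> (Im w - b) / Im \<tau> + of_int i < 0 + 1"
      using assms by (simp add: field_simps)
    ultimately show ?thesis
      using floor_shift_unique[of 0 "(Im w - b) / Im \<tau>" i] by (simp add: l_def)
  qed
  have j_iff: "a \<le> Re w + of_int l * Re \<tau> + of_int i \<and> Re w + of_int l * Re \<tau> + of_int i < a + 1
      \<longleftrightarrow> i = j" for i
    unfolding j_def by (rule floor_shift_unique)
  have "t \<in> {w. a \<le> Re w \<and> Re w < a + 1 \<and> b \<le> Im w \<and> Im w < b + Im \<tau>} \<and> t - w \<in> period_lattice \<tau>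
      \<longleftrightarrow> t = w + of_int l * \<tau> + of_int j" (is "?in t \<longleftrightarrow> _") for t
  proof
    assume t: "?in t"
    then obtain l' j' where eq: "t - w = of_int l' * \<tau> + of_int j'"
      unfolding period_lattice_def by blast
    then have "t = w + of_int l' * \<tau> + of_int j'" by (simp add: algebra_simps)
    with t l_iff[of l'] j_iff[of j'] show "t = w + of_int l * \<tau> + of_int j" by auto
  next
    assume t: "t = w + of_int l * \<tau> + of_int j"
    then have "t - w = of_int l * \<tau> + of_int j" by simp
    with t l_iff[of l] j_iff[of j] show "?in t"
      unfolding period_lattice_def by auto
  qed
  then show "\<exists>!t. t \<in> {w. a \<le> Re w \<and> Re w < a + 1 \<and> b \<le> Im w \<and> Im w < b + Im \<tau>} \<and>
      t - w \<in> period_lattice \<tau>" by simp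
qed

lemma residue_translate:
  "residue f (u + c) = residue (\<lambda>w. f (w + c)) u"
  by (subst (1 2) residue_shift_0) (simp add: add_ac)

text \<open>The value type is left arbitrary so that the lemma serves both for functions and for the
  predicate \<open>\<lambda>w. w \<in> S\<close>.\<close>

lemma periodic_period_lattice:
  assumes per1: "\<And>w. f (w + 1) = f w" and per2: "\<And>w. f (w + \<tau>) = f w"
    and x: "x \<in> period_lattice \<tau>"
  shows "f (w + x) = (f w :: 'b)"
proof -
  interpret one: periodic_fun_simple f 1
    by unfold_locales (rule per1)
  interpret tau: periodic_fun_simple f \<tau>
    by unfold_locales (rule per2)
  obtain l j where x: "x = of_int l * \<tau> + of_int j"
    using x unfolding period_lattice_def by blast
  have "f (w + x) = f ((w + of_int l * \<tau>) + of_int j * 1)" by (simp add: x add_ac)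
  also have "\<dots> = f w" by (simp only: one.plus_of_int tau.plus_of_int)
  finally show ?thesis .
qed

text \<open>The contour is a rectangle and not the parallelogram spanned by \<open>1\<close> and \<open>\<tau>\<close>, so that winding numbers
  are available; both are fundamental domains. The horizontal sides are not translates of each other
  by a period, but an integral over a full period does not depend on its starting point.\<close>

lemma sum_residues_fundamental_domain:
  assumes tau: "Im \<tau> > 0"
    and S: "S sparse_in UNIV" and hol: "h holomorphic_on - S"
    and inv1: "\<And>w. w + 1 \<in> S \<longleftrightarrow> w \<in> S" and inv2: "\<And>w. w + \<tau> \<in> S \<longleftrightarrow> w \<in> S"
    and per1: "\<And>w. h (w + 1) = h w" and per2: "\<And>w. h (w + \<tau>) = h w"
    and T: "fundamental_domain (period_lattice \<tau>) T"
  shows "(\<Sum>u\<in>S \<inter> T. residue h u) = 0"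
proof -
  \<comment> \<open>A sparse set has countably many real and imaginary parts, so some vertical and
    some horizontal line miss \<open>S\<close>. By periodicity of \<open>S\<close> the opposite
    sides miss it too.\<close>
  have "countable S" using sparse_imp_countable[OF open_UNIV S] by simp
  then obtain a b where a: "a \<notin> Re ` S" and b: "b \<notin> Im ` S"
    using exists_real_avoiding_countable by (metis countable_image)
  define c where "c = Complex a b"
  define d where "d = c + 1 + \<i> * Im \<tau>"
  have Scc: "w \<notin> S" if "Re w = a \<or> Im w = b \<or> Re w = a + 1 \<or> Im w = b + Im \<tau>" for w
  proof
    assume "w \<in> S"
    then have "w - 1 \<in> S" "w - \<tau> \<in> S" using inv1[of "w - 1"] inv2[of "w - \<tau>"] by auto
    then have "Re w \<noteq> a" "Im w \<noteq> b" "Re (w - 1) \<noteq> a" "Im (w - \<tau>) \<noteq> b"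
      using a b \<open>w \<in> S\<close> by blast+
    then show False using that by auto
  qed
  have "continuous_on (- S) h" using hol holomorphic_on_imp_continuous_on by blast
  then have cont: "continuous_on X h" if "X \<inter> S = {}" for X
    using that continuous_on_subset by blast
  have zero: "contour_integral (rectpath c d) h = 0"
    unfolding d_def
    by (intro doubly_periodic_contour_integral_rectpath per1 per2; rule cont)
       (use Scc in \<open>auto simp: c_def\<close>)
  obtain r where r: "cbox c d \<subseteq> ball 0 r"
    using bounded_subset_ballD[OF bounded_cbox] by blast
  \<comment> \<open>The residue theorem wants finitely many singularities in an open connected set;
    a ball around the rectangle provides both.\<close>
  define S' where "S' = S \<inter> ball 0 r"
  have "finite (cball 0 r \<inter> S)"
    by (rule sparse_in_compact_finite[OF sparse_in_subset[OF S]]) auto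
  then have fin: "finite S'"
    by (rule finite_subset[rotated]) (auto simp: S'_def)
  have le: "Re c \<le> Re d" "Im c \<le> Im d" using tau by (auto simp: d_def)
  have bd: "path_image (rectpath c d) \<inter> S = {}"
    unfolding path_image_rectpath[OF le] using Scc by (auto simp: c_def d_def)
  have "contour_integral (rectpath c d) h =
      2 * pi * \<i> * (\<Sum>p\<in>S'. winding_number (rectpath c d) p * residue h p)"
  proof (rule Residue_theorem[of "ball 0 r"])
    show "h holomorphic_on ball 0 r - S'"
      by (rule holomorphic_on_subset[OF hol]) (auto simp: S'_def)
    show "path_image (rectpath c d) \<subseteq> ball 0 r - S'"
      using path_image_rectpath_subset_cbox[OF le] r bd by (auto simp: S'_def)
    show "\<forall>z. z \<notin> ball 0 r \<longrightarrow> winding_number (rectpath c d) z = 0"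
      using r winding_number_rectpath_outside[OF le] by blast
  qed (use fin in auto)
  also have "(\<Sum>p\<in>S'. winding_number (rectpath c d) p * residue h p) =
      (\<Sum>p\<in>S \<inter> box c d. residue h p)"
  proof (rule sum.mono_neutral_cong_right)
    show "finite S'" by fact
    show "S \<inter> box c d \<subseteq> S'" using r box_subset_cbox by (fastforce simp: S'_def)
    show "\<forall>i\<in>S' - S \<inter> box c d. winding_number (rectpath c d) i * residue h i = 0"
      using winding_number_rectpath_outside[OF le] path_image_rectpath_cbox_minus_box[OF le] bd
      by (auto simp: S'_def)
    show "winding_number (rectpath c d) x * residue h x = residue h x" if "x \<in> S \<inter> box c d" for x
      using that by (simp add: winding_number_rectpath)
  qed
  \<comment> \<open>No point of \<open>S\<close> lies on the sides, so the open box and the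
    half-open rectangle contain the same singularities.\<close>
  also have "S \<inter> box c d =
      S \<inter> {w. a \<le> Re w \<and> Re w < a + 1 \<and> b \<le> Im w \<and> Im w < b + Im \<tau>}"
    using Scc by (force simp: in_box_complex_iff c_def d_def order.order_iff_strict)
  finally have "(\<Sum>p\<in>S \<inter> {w. a \<le> Re w \<and> Re w < a + 1 \<and> b \<le> Im w \<and> Im w < b + Im \<tau>}. residue h p) = 0"
    using zero by simp
  moreover have "(\<Sum>u\<in>S \<inter> T. residue h u) =
      (\<Sum>p\<in>S \<inter> {w. a \<le> Re w \<and> Re w < a + 1 \<and> b \<le> Im w \<and> Im w < b + Im \<tau>}. residue h p)"
  proof (rule sum_over_fundamental_domains[OF T fundamental_domain_rectangle[OF tau]])
    show "- x \<in> period_lattice \<tau>" if "x \<in> period_lattice \<tau>" for x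
      using that by (rule period_lattice_uminus)
    show "w + x \<in> S" if "x \<in> period_lattice \<tau>" "w \<in> S" for w x
      using periodic_period_lattice[of "\<lambda>w. w \<in> S" \<tau>] that inv1 inv2 by blast
    show "residue h (w + x) = residue h w" if "x \<in> period_lattice \<tau>" "w \<in> S" for w x
      using that by (simp add: residue_translate periodic_period_lattice[of h \<tau>, OF per1 per2])
  qed
  ultimately show ?thesis by simp
qed

subsection \<open>Appell--Lerch sums\<close>

lemma ee_add: "ee (x + y) = ee x * ee y"
  by (simp add: ee_def exp_add ring_distribs)

lemma ee_minus: "ee (- x) = inverse (ee x)"
  by (simp add: ee_def exp_minus)

lemma ee_nonzero [simp]: "ee x \<noteq> 0"
  by (simp add: ee_def)

lemma norm_ee: "norm (ee x) = exp (- 2 * pi * Im x)"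
  by (simp add: ee_def)

lemma ee_of_nat_mult: "ee (of_nat n * x) = ee x ^ n"
  by (simp add: ee_def exp_of_nat_mult [symmetric] mult_ac)

lemma ee_eq_1_iff: "ee x = 1 \<longleftrightarrow> x \<in> \<int>"
proof -
  have "ee x = 1 \<longleftrightarrow> Im x = 0 \<and> (\<exists>n::int. Re x = of_int n)"
    by (auto simp: ee_def exp_eq_1)
  also have "\<dots> \<longleftrightarrow> x \<in> \<int>"
    by (auto simp: complex_eq_iff elim!: Ints_cases intro: complex_is_Int_iff[THEN iffD2])
  finally show ?thesis .
qed

lemma ee_of_int: "ee (of_int n) = 1"
  by (simp add: ee_eq_1_iff)

lemma holomorphic_on_ee [holomorphic_intros]:
  "f holomorphic_on A \<Longrightarrow> (\<lambda>x. ee (f x)) holomorphic_on A"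
  unfolding ee_def by (intro holomorphic_intros)

text \<open>Lattice points closer than \<open>min 1 (Im \<tau>)\<close> coincide: the imaginary part
  of the difference forces the coefficient of \<tau> to be 0, and then an integer of modulus below 1
  remains.\<close>

lemma sparse_in_period_lattice:
  assumes "Im \<tau> > 0"
  shows "period_lattice \<tau> sparse_in UNIV"
proof -
  have "y = x" if x: "x \<in> period_lattice \<tau>" and y: "y \<in> period_lattice \<tau>" and dist: "dist y x < min 1 (Im \<tau>)" for x y
  proof -
    obtain l j where lj: "y - x = of_int l * \<tau> + of_int j"
      using period_lattice_diff[OF y x] unfolding period_lattice_def by blast
    have "\<bar>of_int l * Im \<tau>\<bar> \<le> norm (y - x)"
      using abs_Im_le_cmod[of "y - x"] by (simp add: lj)
    also have "\<dots> < Im \<tau>" using dist by (simp add: dist_norm)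
    finally have "\<bar>real_of_int l\<bar> * Im \<tau> < 1 * Im \<tau>"
      using assms by (simp add: abs_mult)
    then have "l = 0" using assms by (simp add: mult_less_cancel_right)
    moreover have "norm (y - x) < 1" using dist by (simp add: dist_norm)
    ultimately have "\<bar>real_of_int j\<bar> < 1" using lj by simp
    then have "j = 0" by linarith
    with \<open>l = 0\<close> lj show "y = x" by simp
  qed
  then have "\<not> x islimpt period_lattice \<tau>" for x
    using discrete_imp_not_islimpt[of "min 1 (Im \<tau>)" "period_lattice \<tau>" x] assms by force
  then show ?thesis by (simp add: sparse_in_open)
qed

section \<open>Convergence and holomorphy of the Appell-Lerch sum in its second variable\<close>

definition appell_lerch_term :: "real \<Rightarrow> int \<Rightarrow> complex \<Rightarrow> complex \<Rightarrow> int \<Rightarrow> complex \<Rightarrow> complex" where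
  "appell_lerch_term M \<epsilon> z \<tau> n v = (-1) powi (n * \<epsilon>) * ee (- 2 * of_real M * of_int n * v)
        * ee (of_real M * of_int n * of_int (n + 1) * \<tau>)
        / (1 - ee (of_int n * \<tau>) * ee (z - v))"

lemma appell_lerch_eq:
  "appell_lerch M \<epsilon> z v \<tau> =
     ee (of_real M * (z - v)) * (\<Sum>\<^sub>\<infinity>n. appell_lerch_term M \<epsilon> z \<tau> n v)"
  by (simp add: appell_lerch_def appell_lerch_term_def)

lemma appell_lerch_denominator_eq_0_iff:
  "1 - ee (of_int n * \<tau>) * ee (z - v) = 0 \<longleftrightarrow> of_int n * \<tau> + (z - v) \<in> \<int>"
  by (metis ee_add ee_eq_1_iff eq_iff_diff_eq_0)

lemma summable_on_exp_minus_abs_int: "(\<lambda>n::int. exp (- \<bar>real_of_int n\<bar>)) summable_on UNIV"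
proof -
  have "summable (\<lambda>n. exp (-1::real) ^ n)"
    by (rule summable_geometric) simp
  then have "(\<lambda>n. exp (-1::real) ^ n) summable_on UNIV"
    by (subst summable_on_UNIV_nonneg_real_iff) auto
  then have nat: "(\<lambda>n::nat. exp (- real n)) summable_on UNIV"
    by (simp add: exp_of_nat_mult [symmetric])
  have "(\<lambda>n::int. exp (- \<bar>real_of_int n\<bar>)) summable_on range int"
    using nat by (subst summable_on_reindex) (auto simp: o_def inj_on_def)
  moreover have "(\<lambda>n::int. exp (- \<bar>real_of_int n\<bar>)) summable_on range (\<lambda>n. - int n)"
    using nat by (subst summable_on_reindex) (auto simp: o_def inj_on_def)
  then have "(\<lambda>n::int. exp (- \<bar>real_of_int n\<bar>)) summable_on (range (\<lambda>n. - int n) - range int)"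
    by (rule summable_on_subset_banach) auto
  ultimately have "(\<lambda>n::int. exp (- \<bar>real_of_int n\<bar>)) summable_on
      (range int \<union> (range (\<lambda>n. - int n) - range int))"
    by (rule summable_on_Un_disjoint) auto
  moreover have "range int \<union> (range (\<lambda>n. - int n) - range int) = UNIV"
  proof -
    have "n \<in> range int \<union> range (\<lambda>n. - int n)" for n :: int
      by (cases n rule: int_cases2) auto
    then show ?thesis by blast
  qed
  ultimately show ?thesis by simp
qed

text \<open>With \<open>t = \<bar>n\<bar>\<close> the numerator is at most
  \<open>exp (c * t - a * t\<^sup>2)\<close>, uniformly in the strip. Large
  \<open>\<bar>n\<bar>\<close> keeps the denominator away from 0; for the finitely many other
  \<open>n\<close> it may vanish.\<close>

lemma norm_appell_lerch_term_le:
  assumes M: "M > 0" and tau: "Im \<tau> > 0"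
  obtains A N where "\<And>n v. \<bar>Im v\<bar> \<le> B \<Longrightarrow> \<bar>n\<bar> \<ge> N \<Longrightarrow>
    norm (appell_lerch_term M \<epsilon> z \<tau> n v) \<le> A * exp (- \<bar>real_of_int n\<bar>)"
proof -
  define y where "y = Im \<tau>"
  define a where "a = 2 * pi * M * y"
  \<comment> \<open>The first part bounds \<open>ee (- 2 * M * n * v)\<close>; the second bounds the
    linear part of \<open>n * (n + 1)\<close>, which works against the decay when
    \<open>n < 0\<close>.\<close>
  define c where "c = 4 * pi * M * B + a"
  \<comment> \<open>Beyond \<open>N\<close>, \<open>\<bar>n\<bar> * y\<close> exceeds
    \<open>\<bar>Im z\<bar> + B\<close> by at least 1, so \<open>norm w\<close> below is at most
    \<open>exp (-1)\<close> or at least \<open>exp 1\<close>.\<close>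
  define N where "N = \<lceil>(\<bar>Im z\<bar> + B + 1) / y\<rceil>"
  have y: "y > 0" and a: "a > 0" using assms by (simp_all add: y_def a_def)
  have two: "exp (1::real) \<ge> 2" using exp_ge_add_one_self[of 1] by simp
  have "norm (appell_lerch_term M \<epsilon> z \<tau> n v) \<le> (2 * exp ((c + 1)\<^sup>2 / (4 * a))) * exp (- \<bar>real_of_int n\<bar>)"
    if v: "\<bar>Im v\<bar> \<le> B" and n: "\<bar>n\<bar> \<ge> N" for n v
  proof -
    define t where "t = \<bar>real_of_int n\<bar>"
    have "(\<bar>Im z\<bar> + B + 1) / y \<le> t" using n unfolding N_def t_def by linarith
    then have ty: "\<bar>Im z\<bar> + B + 1 \<le> t * y" using y by (simp add: field_simps)
    define w where "w = ee (of_int n * \<tau>) * ee (z - v)"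
    have nw: "norm w = exp (- 2 * pi * (of_int n * y + Im z - Im v))"
      by (simp add: w_def ee_add [symmetric] norm_ee y_def algebra_simps)
    have den: "norm (1 - w) \<ge> 1 / 2"
    proof (cases "n \<ge> 0")
      case True
      then have "of_int n * y + Im z - Im v \<ge> 1" using ty v by (simp add: t_def)
      moreover have "2 * pi \<ge> 1" using pi_ge_two by simp
      ultimately have "1 * 1 \<le> (2 * pi) * (of_int n * y + Im z - Im v)" by (intro mult_mono) auto
      then have "norm w \<le> exp (-1)" unfolding nw by simp
      also have "\<dots> \<le> 1 / 2" using two by (simp add: exp_minus field_simps)
      finally show ?thesis using norm_triangle_ineq2[of 1 w] by simp
    next
      case False
      then have "- (of_int n * y + Im z - Im v) \<ge> 1" using ty v by (simp add: t_def)
      moreover have "2 * pi \<ge> 1" using pi_ge_two by simp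
      ultimately have "1 * 1 \<le> (2 * pi) * (- (of_int n * y + Im z - Im v))" by (intro mult_mono) auto
      then have "norm w \<ge> exp 1" unfolding nw by (simp add: algebra_simps)
      then show ?thesis using norm_triangle_ineq2[of w 1] two by (simp add: norm_minus_commute)
    qed
    have "4 * pi * M * (of_int n * Im v) \<le> 4 * pi * M * (t * B)"
    proof -
      have "of_int n * Im v \<le> \<bar>of_int n * Im v\<bar>" by simp
      also have "\<dots> \<le> t * B" unfolding abs_mult t_def using v by (intro mult_left_mono) auto
      finally show ?thesis using M by simp
    qed
    moreover have "- (a * of_int n) \<le> a * t"
      using mult_left_mono[of "- of_int n" t a] a by (simp add: t_def)
    \<comment> \<open>Completing the square with \<open>c + 1\<close> instead of \<open>c\<close>
      saves one \<open>t\<close> for the factor \<open>exp (- t)\<close>.\<close>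
    moreover have "(c + 1)\<^sup>2 / (4 * a) - (c + 1) * t + a * t\<^sup>2 = (2 * a * t - (c + 1))\<^sup>2 / (4 * a)"
      using a by (simp add: field_simps power2_eq_square)
    then have "(c + 1)\<^sup>2 / (4 * a) - (c + 1) * t + a * t\<^sup>2 \<ge> 0" using a by simp
    moreover have "a * (of_int n * of_int (n + 1)) = a * t\<^sup>2 + a * of_int n"
      by (simp add: t_def algebra_simps power2_eq_square)
    moreover have "(c + 1) * t = 4 * pi * M * (t * B) + a * t + t"
      by (simp add: c_def algebra_simps)
    ultimately have exponent:
      "4 * pi * M * (of_int n * Im v) - a * (of_int n * of_int (n + 1)) \<le> (c + 1)\<^sup>2 / (4 * a) - t"
      by linarith
    have "norm (ee (- 2 * of_real M * of_int n * v)) = exp (4 * pi * M * (of_int n * Im v))"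
      by (simp add: norm_ee)
    moreover have "norm (ee (of_real M * of_int n * of_int (n + 1) * \<tau>)) =
        exp (- (a * (of_int n * of_int (n + 1))))"
    proof -
      have "of_real M * of_int n * of_int (n + 1) * \<tau> = of_real (M * of_int n * of_int (n + 1)) * \<tau>"
        by simp
      then have "Im (of_real M * of_int n * of_int (n + 1) * \<tau>) = M * of_int n * of_int (n + 1) * y"
        by (simp only: Im_complex_of_real Re_complex_of_real times_complex.sel y_def)
      then show ?thesis unfolding norm_ee by (simp only:) (simp add: a_def algebra_simps)
    qed
    ultimately have "norm (appell_lerch_term M \<epsilon> z \<tau> n v) =
        exp (4 * pi * M * (of_int n * Im v) - a * (of_int n * of_int (n + 1))) / norm (1 - w)"
      by (simp only: appell_lerch_term_def w_def norm_mult norm_divide norm_power_int norm_minus_cancel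
          norm_one power_int_1_left mult_1_left exp_add [symmetric] diff_conv_add_uminus)
    also have "\<dots> \<le> exp ((c + 1)\<^sup>2 / (4 * a) - t) / (1 / 2)"
      using exponent den by (intro frac_le) auto
    also have "\<dots> = (2 * exp ((c + 1)\<^sup>2 / (4 * a))) * exp (- t)"
      by (simp add: exp_diff exp_minus field_simps)
    finally show ?thesis by (simp add: t_def)
  qed
  then show thesis by (rule that)
qed

lemma appell_lerch_term_majorant:
  assumes M: "M > 0" and tau: "Im \<tau> > 0" and K: "\<And>v. v \<in> K \<Longrightarrow> \<bar>Im v\<bar> \<le> B"
    and bounded: "\<And>n. n \<in> X \<Longrightarrow> bounded (appell_lerch_term M \<epsilon> z \<tau> n ` K)"
  obtains \<mu> where "\<mu> summable_on X"
    "\<And>n v. n \<in> X \<Longrightarrow> v \<in> K \<Longrightarrow> norm (appell_lerch_term M \<epsilon> z \<tau> n v) \<le> \<mu> n"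
proof -
  obtain A N where AN: "\<And>n v. \<bar>Im v\<bar> \<le> B \<Longrightarrow> \<bar>n\<bar> \<ge> N \<Longrightarrow>
    norm (appell_lerch_term M \<epsilon> z \<tau> n v) \<le> A * exp (- \<bar>real_of_int n\<bar>)"
    using norm_appell_lerch_term_le[OF M tau] by blast
  obtain C where C: "\<And>n v. n \<in> X \<Longrightarrow> v \<in> K \<Longrightarrow> norm (appell_lerch_term M \<epsilon> z \<tau> n v) \<le> C n"
    using bounded unfolding bounded_iff by (metis image_eqI)
  \<comment> \<open>The decay estimate says nothing for \<open>\<bar>n\<bar> < N\<close>; these
    finitely many terms enter with their assumed bounds on \<open>K\<close>.\<close>
  define \<mu> where "\<mu> n = \<bar>A\<bar> * exp (- \<bar>real_of_int n\<bar>) + (if \<bar>n\<bar> < N then \<bar>C n\<bar> else 0)" for n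
  have "(\<lambda>n. if \<bar>n\<bar> < N then \<bar>C n\<bar> else 0) summable_on X"
    by (rule finite_nonzero_values_imp_summable_on, rule finite_subset[of _ "{-N..N}"]) auto
  moreover have "(\<lambda>n. \<bar>A\<bar> * exp (- \<bar>real_of_int n\<bar>)) summable_on X"
    by (intro summable_on_cmult_right summable_on_subset_banach[OF summable_on_exp_minus_abs_int]) auto
  ultimately have "\<mu> summable_on X"
    unfolding \<mu>_def by (rule summable_on_add[rotated])
  moreover have "norm (appell_lerch_term M \<epsilon> z \<tau> n v) \<le> \<mu> n" if n: "n \<in> X" and v: "v \<in> K" for n v
  proof (cases "\<bar>n\<bar> < N")
    case True
    have "norm (appell_lerch_term M \<epsilon> z \<tau> n v) \<le> \<bar>C n\<bar>" using C[OF n v] by simp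
    also have "\<dots> \<le> \<mu> n" using True by (simp add: \<mu>_def)
    finally show ?thesis .
  next
    case False
    have "norm (appell_lerch_term M \<epsilon> z \<tau> n v) \<le> A * exp (- \<bar>real_of_int n\<bar>)"
      using AN[OF K[OF v]] False by simp
    also have "\<dots> \<le> \<bar>A\<bar> * exp (- \<bar>real_of_int n\<bar>)" by (intro mult_right_mono) auto
    also have "\<dots> = \<mu> n" using False by (simp add: \<mu>_def)
    finally show ?thesis .
  qed
  ultimately show thesis by (rule that)
qed

text \<open>On the singleton \<open>{v}\<close> boundedness is automatic, even if a denominator
  vanishes at \<open>v\<close>, where division by zero gives the value 0.\<close>

lemma appell_lerch_term_summable:
  assumes "M > 0" "Im \<tau> > 0"
  shows "(\<lambda>n. appell_lerch_term M \<epsilon> z \<tau> n v) summable_on X"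
proof -
  obtain \<mu> where "\<mu> summable_on X"
    "\<And>n w. n \<in> X \<Longrightarrow> w \<in> {v} \<Longrightarrow> norm (appell_lerch_term M \<epsilon> z \<tau> n w) \<le> \<mu> n"
    using appell_lerch_term_majorant[OF assms, of "{v}" "\<bar>Im v\<bar>" X] by auto
  then have "(\<lambda>n. norm (appell_lerch_term M \<epsilon> z \<tau> n v)) summable_on X"
    by (intro Infinite_Sum.abs_summable_on_comparison_test') auto
  then show ?thesis by (rule abs_summable_summable)
qed

text \<open>The majorant gives uniform convergence on closed discs, hence a holomorphic limit. The
  index set is a parameter so that the term \<open>n = 0\<close>, singular at \<open>v = z\<close>,
  can be left out.\<close>

lemma holomorphic_on_appell_lerch_term_infsum:
  assumes M: "M > 0" and tau: "Im \<tau> > 0" and U: "open U"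
    and den: "\<And>n v. n \<in> X \<Longrightarrow> v \<in> U \<Longrightarrow> of_int n * \<tau> + (z - v) \<notin> \<int>"
  shows "(\<lambda>v. \<Sum>\<^sub>\<infinity>n\<in>X. appell_lerch_term M \<epsilon> z \<tau> n v) holomorphic_on U"
proof -
  have hol: "appell_lerch_term M \<epsilon> z \<tau> n holomorphic_on U" if "n \<in> X" for n
    unfolding appell_lerch_term_def
    by (intro holomorphic_intros) (use den that appell_lerch_denominator_eq_0_iff in blast)
  have "(\<lambda>v. \<Sum>\<^sub>\<infinity>n\<in>X. appell_lerch_term M \<epsilon> z \<tau> n v) field_differentiable (at v)" if v: "v \<in> U" for v
  proof -
    obtain r where r: "r > 0" "cball v r \<subseteq> U" using U v by (meson open_contains_cball)
    have "\<bar>Im w\<bar> \<le> \<bar>Im v\<bar> + r" if "w \<in> cball v r" for w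
      using abs_Im_le_cmod[of "v - w"] that by (simp add: dist_norm)
    moreover have "bounded (appell_lerch_term M \<epsilon> z \<tau> n ` cball v r)" if "n \<in> X" for n
      by (intro compact_imp_bounded compact_continuous_image compact_cball
          holomorphic_on_imp_continuous_on holomorphic_on_subset[OF hol[OF that] r(2)])
    ultimately obtain \<mu> where \<mu>: "\<mu> summable_on X"
      "\<And>n w. n \<in> X \<Longrightarrow> w \<in> cball v r \<Longrightarrow> norm (appell_lerch_term M \<epsilon> z \<tau> n w) \<le> \<mu> n"
      using appell_lerch_term_majorant[OF M tau] by metis
    have lim: "uniform_limit (cball v r) (\<lambda>Y w. \<Sum>n\<in>Y. appell_lerch_term M \<epsilon> z \<tau> n w)
        (\<lambda>w. \<Sum>\<^sub>\<infinity>n\<in>X. appell_lerch_term M \<epsilon> z \<tau> n w) (finite_subsets_at_top X)"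
      by (rule Weierstrass_m_test_general) (use \<mu> in auto)
    have "\<forall>\<^sub>F Y in finite_subsets_at_top X.
        continuous_on (cball v r) (\<lambda>w. \<Sum>n\<in>Y. appell_lerch_term M \<epsilon> z \<tau> n w) \<and>
        (\<lambda>w. \<Sum>n\<in>Y. appell_lerch_term M \<epsilon> z \<tau> n w) holomorphic_on ball v r"
    proof (rule eventually_finite_subsets_at_top_weakI)
      fix Y assume "finite Y" "Y \<subseteq> X"
      then have "(\<lambda>w. \<Sum>n\<in>Y. appell_lerch_term M \<epsilon> z \<tau> n w) holomorphic_on cball v r"
        by (intro holomorphic_on_sum holomorphic_on_subset[OF hol r(2)]) auto
      then show "continuous_on (cball v r) (\<lambda>w. \<Sum>n\<in>Y. appell_lerch_term M \<epsilon> z \<tau> n w) \<and>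
        (\<lambda>w. \<Sum>n\<in>Y. appell_lerch_term M \<epsilon> z \<tau> n w) holomorphic_on ball v r"
        using holomorphic_on_imp_continuous_on holomorphic_on_subset ball_subset_cball by blast
    qed
    then have "(\<lambda>w. \<Sum>\<^sub>\<infinity>n\<in>X. appell_lerch_term M \<epsilon> z \<tau> n w) holomorphic_on ball v r"
      using holomorphic_uniform_limit[OF _ lim] by simp
    then show ?thesis
      by (rule holomorphic_on_imp_differentiable_at) (use r in auto)
  qed
  then show ?thesis
    unfolding holomorphic_on_def using field_differentiable_at_within by blast
qed

lemma appell_lerch_denominator_nonzero:
  assumes "v - z \<notin> period_lattice \<tau>"
  shows "of_int n * \<tau> + (z - v) \<notin> \<int>"
proof
  assume "of_int n * \<tau> + (z - v) \<in> \<int>"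
  then obtain j where "of_int n * \<tau> + (z - v) = of_int j" by (auto elim: Ints_cases)
  then have "v - z = of_int n * \<tau> + of_int (- j)" by (simp add: algebra_simps)
  with assms show False unfolding period_lattice_def by blast
qed

lemma holomorphic_on_appell_lerch:
  assumes M: "M > 0" and tau: "Im \<tau> > 0" and U: "open U"
    and avoid: "\<And>v. v \<in> U \<Longrightarrow> v - z \<notin> period_lattice \<tau>"
  shows "(\<lambda>v. appell_lerch M \<epsilon> z v \<tau>) holomorphic_on U"
proof -
  have "(\<lambda>v. \<Sum>\<^sub>\<infinity>n. appell_lerch_term M \<epsilon> z \<tau> n v) holomorphic_on U"
    by (rule holomorphic_on_appell_lerch_term_infsum[OF M tau U])
       (rule appell_lerch_denominator_nonzero, rule avoid)
  then show ?thesis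
    unfolding appell_lerch_eq by (intro holomorphic_intros)
qed

section \<open>Multipliers of the Appell-Lerch sum and its residue at \<open>v = z\<close>\<close>

lemma appell_lerch_plus_1:
  "appell_lerch (real k / 2) \<epsilon> z (v + 1) \<tau> = (-1) ^ k * appell_lerch (real k / 2) \<epsilon> z v \<tau>"
proof -
  have half: "ee (- (1/2)) = -1"
    by (simp add: ee_def exp_minus)
  \<comment> \<open>Only this prefactor changes sign: in the summands \<open>2 * M = k\<close> is an
    integer, so \<open>v\<close> enters through functions of period 1.\<close>
  have "ee (of_real (real k / 2) * (z - (v + 1))) =
      ee (of_real (real k / 2) * (z - v) + of_nat k * (- (1/2)))"
    by (rule arg_cong[of _ _ ee]) (simp add: field_simps)
  also have "\<dots> = ee (of_real (real k / 2) * (z - v)) * (-1) ^ k"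
    by (simp only: ee_add ee_of_nat_mult half)
  finally have pre: "ee (of_real (real k / 2) * (z - (v + 1))) =
      ee (of_real (real k / 2) * (z - v)) * (-1) ^ k" .
  have "appell_lerch_term (real k / 2) \<epsilon> z \<tau> n (v + 1) = appell_lerch_term (real k / 2) \<epsilon> z \<tau> n v" for n
  proof -
    have "ee (- 2 * of_real (real k / 2) * of_int n * (v + 1)) =
        ee (- 2 * of_real (real k / 2) * of_int n * v + of_int (- int k * n))"
      by (rule arg_cong[of _ _ ee]) (simp add: field_simps)
    moreover have "ee (z - (v + 1)) = ee (z - v + of_int (-1))"
      by (rule arg_cong[of _ _ ee]) simp
    ultimately show ?thesis
      unfolding appell_lerch_term_def by (simp only: ee_add ee_of_int mult_1_right)
  qed
  then show ?thesis unfolding appell_lerch_eq pre by simp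
qed

text \<open>Moving \<open>v\<close> by \<tau> is undone in the denominators by moving
  \<open>n\<close> to \<open>n + 1\<close>. In the numerators this leaves
  \<open>ee (- 2 * M * v)\<close> and the sign, because
  \<open>(n + 1) * (n + 2) - 2 * (n + 1) = n * (n + 1)\<close>; the prefactor adds
  \<open>ee (- M * \<tau>)\<close>.\<close>

lemma appell_lerch_plus_period:
  "appell_lerch M \<epsilon> z (v + \<tau>) \<tau> =
    (-1) powi \<epsilon> * ee (- of_real M * (\<tau> + 2 * v)) * appell_lerch M \<epsilon> z v \<tau>"
proof -
  have shift: "appell_lerch_term M \<epsilon> z \<tau> (n + 1) (v + \<tau>) =
      (-1) powi \<epsilon> * ee (- of_real M * 2 * v) * appell_lerch_term M \<epsilon> z \<tau> n v" for n
  proof -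
    have "ee (- 2 * of_real M * of_int (n + 1) * (v + \<tau>)) *
        ee (of_real M * of_int (n + 1) * of_int (n + 1 + 1) * \<tau>) =
      ee (- of_real M * 2 * v) * (ee (- 2 * of_real M * of_int n * v) *
        ee (of_real M * of_int n * of_int (n + 1) * \<tau>))"
      unfolding ee_add [symmetric] by (rule arg_cong[of _ _ ee]) (simp add: algebra_simps)
    moreover have "ee (of_int (n + 1) * \<tau>) * ee (z - (v + \<tau>)) = ee (of_int n * \<tau>) * ee (z - v)"
      unfolding ee_add [symmetric] by (rule arg_cong[of _ _ ee]) (simp add: algebra_simps)
    moreover have "(-1 :: complex) powi ((n + 1) * \<epsilon>) = (-1) powi \<epsilon> * (-1) powi (n * \<epsilon>)"
      by (simp add: distrib_right power_int_add)
    ultimately show ?thesis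
      unfolding appell_lerch_term_def by (simp add: mult.assoc mult.left_commute)
  qed
  have "(\<Sum>\<^sub>\<infinity>n. appell_lerch_term M \<epsilon> z \<tau> n (v + \<tau>)) =
      (\<Sum>\<^sub>\<infinity>n. appell_lerch_term M \<epsilon> z \<tau> (n + 1) (v + \<tau>))"
    by (rule infsum_reindex_bij_witness[of _ "\<lambda>n. n + 1" "\<lambda>n. n - 1"]) auto
  also have "\<dots> = (-1) powi \<epsilon> * ee (- of_real M * 2 * v) * (\<Sum>\<^sub>\<infinity>n. appell_lerch_term M \<epsilon> z \<tau> n v)"
    by (simp only: shift infsum_cmult_right')
  finally have sum: "(\<Sum>\<^sub>\<infinity>n. appell_lerch_term M \<epsilon> z \<tau> n (v + \<tau>)) =
    (-1) powi \<epsilon> * ee (- of_real M * 2 * v) * (\<Sum>\<^sub>\<infinity>n. appell_lerch_term M \<epsilon> z \<tau> n v)" .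
  have pre: "ee (of_real M * (z - (v + \<tau>))) * ee (- of_real M * 2 * v) =
      ee (- of_real M * (\<tau> + 2 * v)) * ee (of_real M * (z - v))"
    unfolding ee_add [symmetric] by (rule arg_cong[of _ _ ee]) (simp add: algebra_simps)
  show ?thesis
    unfolding appell_lerch_eq sum using pre by (simp add: mult_ac)
qed

lemma residue_appell_lerch:
  assumes M: "M > 0" and tau: "Im \<tau> > 0" and r: "r > 0" and f: "f holomorphic_on ball z r"
  shows "residue (\<lambda>v. f v * appell_lerch M \<epsilon> z v \<tau>) z = f z / (2 * pi * \<i>)"
proof -
  have "\<not> 0 islimpt period_lattice \<tau>"
    using sparse_in_period_lattice[OF tau] by (simp add: sparse_in_open)
  then obtain s where s: "s > 0" "\<And>x. x \<in> period_lattice \<tau> \<Longrightarrow> x \<noteq> 0 \<Longrightarrow> norm x \<ge> s"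
    \<comment> \<open>\<open>s\<close> bounds the nonzero lattice points away from 0, so in the disc
      of radius \<open>t\<close> the only point congruent to \<open>z\<close> is \<open>z\<close>
      itself.\<close>
    unfolding islimpt_approachable by (auto simp: not_less)
  define t where "t = min r s"
  have t: "t > 0" "ball z t \<subseteq> ball z r" using r s(1) by (auto simp: t_def)
  have avoid: "v - z \<notin> period_lattice \<tau>" if "v \<in> ball z t - {z}" for v
    using s(2)[of "v - z"] that by (auto simp: t_def dist_norm norm_minus_commute)
  \<comment> \<open>Everything but the singular term; \<open>G\<close> is holomorphic even at
    \<open>z\<close>, since \<open>n * \<tau>\<close> is not an integer for
    \<open>n \<noteq> 0\<close>.\<close>
  define G where "G v = (\<Sum>\<^sub>\<infinity>n\<in>-{0}. appell_lerch_term M \<epsilon> z \<tau> n v)" for v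
  have "of_int n * \<tau> + (z - v) \<notin> \<int>" if "n \<in> - {0}" "v \<in> ball z t" for n v
  proof (cases "v = z")
    case True
    then show ?thesis using that tau by (auto simp: complex_is_Int_iff)
  next
    case False
    then show ?thesis using that by (intro appell_lerch_denominator_nonzero avoid) auto
  qed
  then have G: "G holomorphic_on ball z t"
    unfolding G_def by (intro holomorphic_on_appell_lerch_term_infsum M tau) auto
  have split: "appell_lerch M \<epsilon> z v \<tau> = ee (of_real M * (z - v)) * (1 / (1 - ee (z - v)) + G v)" for v
  proof -
    have UNIV: "insert 0 (- {0}) = (UNIV :: int set)" by auto
    have "(\<Sum>\<^sub>\<infinity>n. appell_lerch_term M \<epsilon> z \<tau> n v) = appell_lerch_term M \<epsilon> z \<tau> 0 v + G v"
      using infsum_insert[OF appell_lerch_term_summable[OF M tau], of 0 "-{0}" \<epsilon> z v]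
      by (simp add: G_def UNIV)
    moreover have "appell_lerch_term M \<epsilon> z \<tau> 0 v = 1 / (1 - ee (z - v))"
      by (simp add: appell_lerch_term_def ee_def)
    ultimately show ?thesis by (simp add: appell_lerch_eq)
  qed
  have z: "z \<in> ball z t" using t(1) by simp
  have tends: "(g \<longlongrightarrow> g z) (at z)" if "g holomorphic_on ball z t" for g :: "complex \<Rightarrow> complex"
    using holomorphic_on_imp_continuous_on[OF that] z
    by (simp add: continuous_on_eq_continuous_at isCont_def)
  have "((\<lambda>v. 1 - ee (z - v)) has_field_derivative 2 * pi * \<i>) (at z)"
    unfolding ee_def by (auto intro!: derivative_eq_intros)
  then have "((\<lambda>v. (1 - ee (z - v)) / (v - z)) \<longlongrightarrow> 2 * pi * \<i>) (at z)"
    by (simp add: has_field_derivative_iff ee_def)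
  then have quot: "((\<lambda>v. inverse ((1 - ee (z - v)) / (v - z))) \<longlongrightarrow> inverse (2 * pi * \<i>)) (at z)"
    by (rule tendsto_inverse) simp
  have ee0: "ee 0 = 1" by (simp add: ee_def)
  have lim: "((\<lambda>v. f v * ee (of_real M * (z - v)) * (inverse ((1 - ee (z - v)) / (v - z)) + G v * (v - z)))
      \<longlongrightarrow> f z * ee (of_real M * (z - z)) * (inverse (2 * pi * \<i>) + G z * (z - z))) (at z)"
    by (intro tendsto_mult tendsto_add quot tends holomorphic_on_subset[OF f t(2)] G)
       (auto intro!: tends holomorphic_intros tendsto_intros)
  have eq: "f v * appell_lerch M \<epsilon> z v \<tau> * (v - z) =
      f v * ee (of_real M * (z - v)) * (inverse ((1 - ee (z - v)) / (v - z)) + G v * (v - z))" for v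
    unfolding split inverse_divide by (simp only: mult.assoc distrib_right times_divide_eq_left mult_1_left)
  have c: "f z * ee (of_real M * (z - z)) * (inverse (2 * pi * \<i>) + G z * (z - z)) = f z / (2 * pi * \<i>)"
    by (simp add: ee0 inverse_eq_divide)
  show ?thesis
  proof (rule residue_simple'[of "ball z t"])
    have "(\<lambda>v. appell_lerch M \<epsilon> z v \<tau>) holomorphic_on ball z t - {z}"
      by (rule holomorphic_on_appell_lerch[OF M tau _ avoid]) (auto intro: open_delete)
    moreover have "f holomorphic_on ball z t - {z}"
      by (rule holomorphic_on_subset[OF f]) (use t(2) in blast)
    ultimately show "(\<lambda>v. f v * appell_lerch M \<epsilon> z v \<tau>) holomorphic_on ball z t - {z}"
      by (intro holomorphic_on_mult)
    show "((\<lambda>w. f w * appell_lerch M \<epsilon> z w \<tau> * (w - z)) \<longlongrightarrow> f z / (2 * pi * \<i>)) (at z)"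
      using lim unfolding eq c .
  qed (use t in auto)
qed

subsection \<open>Principal parts\<close>

lemma residue_sum:
  assumes "finite A" "open s" "u \<in> s" "\<And>i. i \<in> A \<Longrightarrow> f i holomorphic_on s - {u}"
  shows "residue (\<lambda>v. \<Sum>i\<in>A. f i v) u = (\<Sum>i\<in>A. residue (f i) u)"
  using assms(1,4)
proof (induction rule: finite_induct)
  case empty
  then show ?case by (simp add: residue_const)
next
  case (insert i A)
  have "residue (\<lambda>v. f i v + (\<Sum>i\<in>A. f i v)) u = residue (f i) u + residue (\<lambda>v. \<Sum>i\<in>A. f i v) u"
    using insert by (intro residue_add[OF assms(2,3)] holomorphic_on_sum) auto
  then show ?case using insert by simp
qed

text \<open>Each polar term of order \<open>n\<close> extracts the Taylor coefficient of
  \<open>f\<close> of order \<open>n - 1\<close>, and the holomorphic remainder contributes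
  nothing.\<close>

lemma residue_principal_part_mult:
  assumes pp: "principal_part \<phi> u N D" and s: "s > 0" and f: "f holomorphic_on ball u s"
  shows "residue (\<lambda>v. \<phi> v * f v) u =
    (\<Sum>n=1..N. D n / (2 * pi * \<i>) ^ n * ((deriv ^^ (n - 1)) f u / fact (n - 1)))"
proof -
  obtain g r where r: "r > 0" and g: "g holomorphic_on ball u r"
    and \<phi>: "\<And>v. v \<in> ball u r - {u} \<Longrightarrow> \<phi> v = (\<Sum>n=1..N. D n / (2 * pi * \<i> * (v - u)) ^ n) + g v"
    using pp unfolding principal_part_def by blast
  define U where "U = ball u (min r s)"
  have U: "open U" "u \<in> U" "U \<subseteq> ball u r" "U \<subseteq> ball u s" using r s by (auto simp: U_def)
  have fU: "f holomorphic_on U" and gU: "g holomorphic_on U"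
    using f g U holomorphic_on_subset by blast+
  define t where "t n v = D n / (2 * pi * \<i>) ^ n * (f v / (v - u) ^ n)" for n v
  have t: "t n holomorphic_on U - {u}" for n
    unfolding t_def by (intro holomorphic_intros holomorphic_on_subset[OF fU]) auto
  have "\<phi> v * f v = (\<Sum>n=1..N. t n v) + g v * f v" if "v \<in> U - {u}" for v
  proof -
    have "\<phi> v * f v = (\<Sum>n=1..N. D n / (2 * pi * \<i> * (v - u)) ^ n * f v) + g v * f v"
      using \<phi>[of v] that U(3) by (auto simp: distrib_right sum_distrib_right)
    then show ?thesis by (simp add: t_def power_mult_distrib)
  qed
  moreover have "eventually (\<lambda>v. v \<in> U - {u}) (at u)"
    using U eventually_at_in_open by blast
  ultimately have "residue (\<lambda>v. \<phi> v * f v) u = residue (\<lambda>v. (\<Sum>n=1..N. t n v) + g v * f v) u"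
    by (intro residue_cong) (auto elim: eventually_mono)
  also have "\<dots> = residue (\<lambda>v. \<Sum>n=1..N. t n v) u + residue (\<lambda>v. g v * f v) u"
    by (intro residue_add[OF U(1,2)] holomorphic_on_sum t holomorphic_on_mult
        holomorphic_on_subset[OF fU] holomorphic_on_subset[OF gU]) auto
  also have "residue (\<lambda>v. g v * f v) u = 0"
    by (intro residue_holo[OF U(1,2)] holomorphic_on_mult fU gU)
  also have "residue (\<lambda>v. \<Sum>n=1..N. t n v) u = (\<Sum>n=1..N. residue (t n) u)"
    by (intro residue_sum[OF _ U(1,2)] t) auto
  also have "\<dots> = (\<Sum>n=1..N. D n / (2 * pi * \<i>) ^ n * ((deriv ^^ (n - 1)) f u / fact (n - 1)))"
  proof (rule sum.cong)
    fix n assume n: "n \<in> {1..N}"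
    have "residue (t n) u = D n / (2 * pi * \<i>) ^ n * residue (\<lambda>v. f v / (v - u) ^ n) u"
      unfolding t_def
      by (intro residue_lmul[OF U(1,2)] holomorphic_intros holomorphic_on_subset[OF fU]) auto
    also have "residue (\<lambda>v. f v / (v - u) ^ n) u = (deriv ^^ (n - 1)) f u / fact (n - 1)"
    proof -
      have "Suc (n - 1) = n" using n by simp
      then show ?thesis using residue_holomorphic_over_power[OF U(1,2) fU, of "n - 1"] by (simp only:)
    qed
    finally show "residue (t n) u = D n / (2 * pi * \<i>) ^ n * ((deriv ^^ (n - 1)) f u / fact (n - 1))" .
  qed simp
  finally show ?thesis by simp
qed

text \<open>\<open>Dnorm_iter (n - 1)\<close> absorbs \<open>n - 1\<close> of the \<open>n\<close>
  factors \<open>1 / (2 * pi * \<i>)\<close>; the remaining one no longer depends on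
  \<open>n\<close> and is pulled out.\<close>

lemma residue_principal_part_mult_Dnorm_iter:
  assumes pp: "principal_part \<phi> u N D" and s: "s > 0" and f: "f holomorphic_on ball u s"
  shows "residue (\<lambda>v. \<phi> v * f v) u =
    (\<Sum>\<^sub>\<infinity>n\<in>{1..}. D n / of_nat (fact (n - 1)) * Dnorm_iter (n - 1) f u) / (2 * pi * \<i>)"
proof -
  have D: "D n = 0" if "n > N" for n using pp that unfolding principal_part_def by blast
  have "(\<Sum>\<^sub>\<infinity>n\<in>{1..}. D n / of_nat (fact (n - 1)) * Dnorm_iter (n - 1) f u) =
      (\<Sum>\<^sub>\<infinity>n\<in>{1..N}. D n / of_nat (fact (n - 1)) * Dnorm_iter (n - 1) f u)"
    by (rule infsum_cong_neutral) (auto intro: D)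
  also have "\<dots> = (\<Sum>n=1..N. D n / of_nat (fact (n - 1)) * Dnorm_iter (n - 1) f u)"
    by simp
  finally have "(\<Sum>\<^sub>\<infinity>n\<in>{1..}. D n / of_nat (fact (n - 1)) * Dnorm_iter (n - 1) f u) / (2 * pi * \<i>) =
      (\<Sum>n=1..N. D n / of_nat (fact (n - 1)) * Dnorm_iter (n - 1) f u / (2 * pi * \<i>))"
    by (simp add: sum_divide_distrib)
  also have "\<dots> = (\<Sum>n=1..N. D n / (2 * pi * \<i>) ^ n * ((deriv ^^ (n - 1)) f u / fact (n - 1)))"
  proof (rule sum.cong)
    fix n assume "n \<in> {1..N}"
    then obtain j where j: "n = Suc j" by (cases n) auto
    define c where "c = 2 * complex_of_real pi * \<i>"
    have "c \<noteq> 0" by (simp add: c_def)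
    then have "D n / fact j * ((1 / c) ^ j * (deriv ^^ j) f u) / c =
        D n / c ^ Suc j * ((deriv ^^ j) f u / fact j)"
      by (simp add: power_one_over field_simps)
    then show "D n / of_nat (fact (n - 1)) * Dnorm_iter (n - 1) f u / (2 * pi * \<i>) =
        D n / (2 * pi * \<i>) ^ n * ((deriv ^^ (n - 1)) f u / fact (n - 1))"
      by (simp add: j Dnorm_iter_def c_def)
  qed simp
  finally show ?thesis using residue_principal_part_mult[OF assms] by simp
qed

lemma principal_part_laurent_coeff:
  assumes "Defs.is_pole \<phi> u"
  obtains N where "principal_part \<phi> u N (laurent_coeff \<phi> u)"
proof -
  have "\<exists>D. \<exists>N. principal_part \<phi> u N D"
    using assms unfolding Defs.is_pole_def by blast
  then have "\<exists>N. principal_part \<phi> u N (laurent_coeff \<phi> u)"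
    unfolding laurent_coeff_def by (rule someI_ex)
  then show thesis using that by blast
qed

text \<open>Duality between monomials and derivatives at \<open>u\<close>: multiplying by
  \<open>(v - u) ^ (p - 1)\<close> isolates the Laurent coefficient of index
  \<open>p\<close>.\<close>

lemma higher_deriv_power_at_center:
  assumes "n \<ge> 1" "p \<ge> 1"
  shows "(deriv ^^ (n - 1)) (\<lambda>v. (v - u) ^ (p - 1)) u = (if n = p then fact (p - 1) else 0 :: complex)"
proof (cases n p rule: linorder_cases)
  case less
  then show ?thesis using assms by (simp add: higher_deriv_power power_0_left)
next
  case equal
  then show ?thesis using assms by (simp add: higher_deriv_power pochhammer_fact)
next
  case greater
  \<comment> \<open>The truncated difference is the start of the Pochhammer factor in the
    derivative; starting at 0 with positive length, it vanishes.\<close>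
  then have "p - (n - 1) = 0" "n - 1 \<noteq> 0" using assms by auto
  then show ?thesis using greater assms by (simp add: higher_deriv_power pochhammer_0_left)
qed

text \<open>The residues of \<open>(v - u) ^ (p - 1) * \<phi> v\<close> recover all Laurent coefficients, and they vanish
  if \<open>\<phi>\<close> extends holomorphically.\<close>

lemma is_pole_not_removable:
  assumes pole: "Defs.is_pole \<phi> u" and r: "r > 0" and \<psi>: "\<psi> holomorphic_on ball u r"
    and ev: "eventually (\<lambda>v. \<phi> v = \<psi> v) (at u)"
  shows False
proof -
  obtain N D p where pp: "principal_part \<phi> u N D" and p: "D p \<noteq> 0"
    using pole unfolding Defs.is_pole_def by blast
  then have pN: "1 \<le> p" "p \<le> N" unfolding principal_part_def by (metis not_less less_one, metis not_less)
  have hol: "(\<lambda>v. (v - u) ^ (p - 1)) holomorphic_on ball u r" by (intro holomorphic_intros)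
  have "0 = residue (\<lambda>v. \<psi> v * (v - u) ^ (p - 1)) u"
    using r by (intro residue_holo[symmetric, of "ball u r"] holomorphic_on_mult \<psi> hol) auto
  also have "\<dots> = residue (\<lambda>v. \<phi> v * (v - u) ^ (p - 1)) u"
    by (rule residue_cong) (use ev in \<open>auto elim: eventually_mono\<close>)
  also have "\<dots> = (\<Sum>n=1..N. D n / (2 * pi * \<i>) ^ n *
      ((deriv ^^ (n - 1)) (\<lambda>v. (v - u) ^ (p - 1)) u / fact (n - 1)))"
    by (rule residue_principal_part_mult[OF pp r hol])
  also have "\<dots> = (\<Sum>n=1..N. if n = p then D p / (2 * pi * \<i>) ^ p else 0)"
    using pN by (intro sum.cong) (auto simp: higher_deriv_power_at_center simp del: One_nat_def)
  also have "\<dots> = D p / (2 * pi * \<i>) ^ p" using pN by simp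
  finally show False using p by simp
qed

section \<open>Discreteness and lattice invariance of the pole set\<close>

lemma sparse_in_poles:
  assumes "meromorphic_with_poles \<phi> P"
  shows "P sparse_in UNIV"
proof -
  have "\<not> u islimpt P" for u
  proof -
    obtain e where "e > 0" "\<And>w. w \<in> ball u e \<Longrightarrow> w \<in> P \<Longrightarrow> w = u"
      using assms unfolding meromorphic_with_poles_def by blast
    then show ?thesis unfolding islimpt_approachable by (auto simp: dist_commute)
  qed
  then show ?thesis by (simp add: sparse_in_open)
qed

lemma bounded_fund_par: "bounded (fund_par z0 \<tau>)"
proof -
  have "norm (z0 + of_real a * \<tau> + of_real b) \<le> norm z0 + norm \<tau> + 1"
    if "0 \<le> a" "a < 1" "0 \<le> b" "b < 1" for a b
  proof -
    have "norm (z0 + of_real a * \<tau> + of_real b) \<le> norm z0 + norm (of_real a * \<tau>) + norm (of_real b :: complex)"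
      by (intro norm_triangle_le add_mono order_refl)
    also have "norm (of_real a * \<tau>) \<le> 1 * norm \<tau>"
      unfolding norm_mult using that by (intro mult_right_mono) auto
    also have "norm (of_real b :: complex) \<le> 1" using that by simp
    finally show ?thesis by simp
  qed
  then show ?thesis unfolding fund_par_def bounded_iff by blast
qed

text \<open>If \<open>u + x\<close> were a regular point, \<open>\<phi> (w + x) / a w\<close> would
  be holomorphic near \<open>u\<close> and agree there with \<phi> off \<open>P\<close>, removing
  the singularity at \<open>u\<close>.\<close>

lemma poles_period_lattice_invariant:
  assumes mero: "meromorphic_with_poles \<phi> P"
    and transf: "\<And>w. w \<notin> P \<Longrightarrow> w + x \<notin> P \<Longrightarrow> \<phi> (w + x) = a w * \<phi> w"
    and a: "a holomorphic_on UNIV" "\<And>w. a w \<noteq> 0"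
    and u: "u \<in> P"
  shows "u + x \<in> P"
proof (rule ccontr)
  assume ux: "u + x \<notin> P"
  have sparse: "P sparse_in UNIV" by (rule sparse_in_poles[OF mero])
  then have "open (- P)" by (intro open_Compl sparse_in_UNIV_imp_closed)
  with ux obtain r where r: "r > 0" "ball (u + x) r \<subseteq> - P"
    by (meson ComplI open_contains_ball)
  have subP: "w + x \<notin> P" if "dist u w < r" for w
  proof -
    have "w + x \<in> ball (u + x) r" using that by (simp add: dist_norm)
    then show ?thesis using r(2) by blast
  qed
  have \<phi>: "\<phi> holomorphic_on - P" and pole: "Defs.is_pole \<phi> u"
    using mero u unfolding meromorphic_with_poles_def by auto
  have hol: "(\<lambda>w. \<phi> (w + x) / a w) holomorphic_on ball u r"
  proof (rule holomorphic_on_divide)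
    have "(\<phi> \<circ> (\<lambda>w. w + x)) holomorphic_on ball u r"
      by (rule holomorphic_on_compose_gen[of _ _ _ "- P"])
         (use \<phi> subP in \<open>auto intro!: holomorphic_intros\<close>)
    then show "(\<lambda>w. \<phi> (w + x)) holomorphic_on ball u r" by (simp add: o_def)
  qed (use a in \<open>auto intro: holomorphic_on_subset\<close>)
  have "eventually (\<lambda>w. w \<notin> P) (at u)"
    using sparse by (simp add: sparse_in_eventually_iff)
  moreover have "eventually (\<lambda>w. w \<in> ball u r) (at u)"
    using r(1) by (intro eventually_at_in_open') auto
  ultimately have "eventually (\<lambda>w. \<phi> w = \<phi> (w + x) / a w) (at u)"
  proof eventually_elim
    case (elim w)
    then show ?case using transf[of w] subP[of w] a(2)[of w] by auto
  qed
  then show False using is_pole_not_removable[OF pole r(1) hol] by blast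
qed

theorem theorem1p1:
  fixes \<tau> z0 z :: complex and m :: real and k :: nat and \<epsilon> :: int
    and \<phi> :: "complex \<Rightarrow> complex" and P :: "complex set"
  assumes tau: "Im \<tau> > 0"
    and m: "k \<ge> 1" "m = - real k / 2"
    and eps: "\<epsilon> \<in> {0, 1}"
    and mero: "meromorphic_with_poles \<phi> P"
    and transf: "\<And>(l::int) (j::int) w. w \<notin> P \<Longrightarrow> w + of_int l * \<tau> + of_int j \<notin> P \<Longrightarrow>
        \<phi> (w + of_int l * \<tau> + of_int j)
          = (-1) powi (- int k * j + l * \<epsilon>)
            * ee (- of_real m * (of_int l ^ 2 * \<tau> + 2 * of_int l * w)) * \<phi> w"
    and bdry: "P \<inter> frontier (fund_par z0 \<tau>) = {}"
    and z: "z \<notin> P"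
  shows "\<phi> z = - (\<Sum>u\<in>P \<inter> fund_par z0 \<tau>.
            \<Sum>\<^sub>\<infinity>n\<in>{1::nat..}. laurent_coeff \<phi> u n / of_nat (fact (n - 1))
              * Dnorm_iter (n - 1) (\<lambda>v. appell_lerch (- m) \<epsilon> z v \<tau>) u)"
proof -
  define F where "F v = appell_lerch (- m) \<epsilon> z v \<tau>" for v
  define L where "L = period_lattice \<tau>"
  define S where "S = P \<union> {w. w - z \<in> L}"
  \<comment> \<open>The value 0 on \<open>S\<close> makes \<open>h\<close> periodic everywhere: nothing is known about \<open>\<phi>\<close> on \<open>P\<close>.\<close>
  define h where "h w = (if w \<in> S then 0 else \<phi> w * F w)" for w
  define T where "T = fund_par z0 \<tau>"
  have M: "- m > 0" and mk: "- m = real k / 2" using m by auto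
  have \<phi>: "\<phi> holomorphic_on - P" and pole: "\<And>u. u \<in> P \<Longrightarrow> Defs.is_pole \<phi> u"
    using mero unfolding meromorphic_with_poles_def by auto
  have Psparse: "P sparse_in UNIV" by (rule sparse_in_poles[OF mero])
  have "{w. w - z \<in> L} = (+) z ` L" by (auto simp: image_iff intro!: bexI[of _ "_ - z"])
  then have zLsparse: "{w. w - z \<in> L} sparse_in UNIV"
    using sparse_in_translate_UNIV[OF sparse_in_period_lattice[OF tau]] by (simp add: L_def)
  have Ssparse: "S sparse_in UNIV"
    unfolding S_def using Psparse zLsparse by (rule sparse_in_union')
  have not_S: "eventually (\<lambda>w. w \<notin> S) (at u)" for u
    using Ssparse by (simp add: sparse_in_eventually_iff)
  have open_P: "open (- P)" and open_zL: "open (- {w. w - z \<in> L})"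
    using Psparse zLsparse by (auto intro: open_Compl sparse_in_UNIV_imp_closed)

  have Pinv: "u + x \<in> P" if x: "x \<in> L" and u: "u \<in> P" for u x
  proof -
    obtain l j where lj: "x = of_int l * \<tau> + of_int j"
      using x unfolding L_def period_lattice_def by blast
    show ?thesis
    proof (rule poles_period_lattice_invariant[OF mero _ _ _ u])
      show "\<phi> (w + x) = ((-1) powi (- int k * j + l * \<epsilon>)
            * ee (- of_real m * (of_int l ^ 2 * \<tau> + 2 * of_int l * w))) * \<phi> w"
        if "w \<notin> P" "w + x \<notin> P" for w
        using transf[of w l j] that by (simp add: lj add.assoc)
    qed (auto intro!: holomorphic_intros)
  qed
  have Sinv: "w + x \<in> S" if "x \<in> L" "w \<in> S" for w x
  proof (cases "w \<in> P")
    case True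
    then show ?thesis using Pinv[OF that(1)] by (simp add: S_def)
  next
    case False
    then have "(w - z) + x \<in> L"
      using that unfolding S_def L_def by (intro period_lattice_add) auto
    then show ?thesis by (simp add: S_def diff_add_eq)
  qed
  have Sinv_iff: "w + x \<in> S \<longleftrightarrow> w \<in> S" if "x \<in> L" for w x
    using Sinv[OF that, of w] Sinv[of "- x" "w + x"] period_lattice_uminus[of x \<tau>] that
    by (auto simp: L_def)
  \<comment> \<open>A pole congruent to \<open>z\<close> would make \<open>z\<close> a pole. Hence
    the two kinds of singularities never collide and their residues can be computed
    separately.\<close>
  have disj: "P \<inter> {w. w - z \<in> L} = {}"
  proof -
    have "z \<in> P" if "u \<in> P" "u - z \<in> L" for u
      using Pinv[of "z - u" u] that period_lattice_uminus[of "u - z" \<tau>] by (simp add: L_def)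
    then show ?thesis using z by blast
  qed

  have F: "F holomorphic_on - {w. w - z \<in> L}"
    unfolding F_def by (rule holomorphic_on_appell_lerch[OF M tau open_zL]) (simp add: L_def)
  have "(\<lambda>w. \<phi> w * F w) holomorphic_on - S"
    by (intro holomorphic_on_mult holomorphic_on_subset[OF \<phi>] holomorphic_on_subset[OF F])
       (auto simp: S_def)
  then have hol: "h holomorphic_on - S"
    by (rule holomorphic_transform) (simp add: h_def)

  have one: "1 \<in> L" and tauL: "\<tau> \<in> L" by (simp_all add: L_def period_lattice_generators)
  \<comment> \<open>Both factors pick up \<open>(-1) ^ k\<close>, which squares to 1.\<close>
  have per1: "h (w + 1) = h w" for w
  proof (cases "w \<in> S")
    case True
    then show ?thesis using Sinv_iff[OF one] by (simp add: h_def)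
  next
    case False
    then have notS: "w + 1 \<notin> S" using Sinv_iff[OF one] by simp
    have "\<phi> (w + 1) = (-1) powi (- int k) * \<phi> w"
      using transf[of w 0 1] False notS by (simp add: S_def ee_def)
    also have "(-1 :: complex) powi (- int k) = (-1) ^ k"
      by (simp add: power_int_minus flip: power_inverse)
    finally have "\<phi> (w + 1) * F (w + 1) = ((-1) ^ k * (-1) ^ k) * (\<phi> w * F w)"
      unfolding F_def mk appell_lerch_plus_1 by (simp only: mult_ac)
    then show ?thesis using False notS by (simp add: h_def flip: power_mult_distrib)
  qed
  \<comment> \<open>With \<open>M = - m\<close> the two exponential factors are reciprocal, and the
    sign \<open>(-1) powi \<epsilon>\<close> occurs twice.\<close>
  have per2: "h (w + \<tau>) = h w" for w
  proof (cases "w \<in> S")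
    case True
    then show ?thesis using Sinv_iff[OF tauL] by (simp add: h_def)
  next
    case False
    then have notS: "w + \<tau> \<notin> S" using Sinv_iff[OF tauL] by simp
    have \<phi>\<tau>: "\<phi> (w + \<tau>) = (-1) powi \<epsilon> * ee (- of_real m * (\<tau> + 2 * w)) * \<phi> w"
      using transf[of w 1 0] False notS by (simp add: S_def)
    have F\<tau>: "F (w + \<tau>) = (-1) powi \<epsilon> * inverse (ee (- of_real m * (\<tau> + 2 * w))) * F w"
      unfolding F_def appell_lerch_plus_period ee_minus[symmetric] by simp
    have "(-1) powi \<epsilon> * (-1) powi \<epsilon> = (1::complex)" using eps by auto
    then have "\<phi> (w + \<tau>) * F (w + \<tau>) = \<phi> w * F w"
      unfolding \<phi>\<tau> F\<tau> by (simp add: field_simps)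
    then show ?thesis using False notS by (simp add: h_def)
  qed

  have "(\<Sum>u\<in>S \<inter> T. residue h u) = 0"
    unfolding T_def
    using Sinv_iff[OF one] Sinv_iff[OF tauL]
    by (intro sum_residues_fundamental_domain[OF tau Ssparse hol] per1 per2 fundamental_domain_fund_par tau)
  \<comment> \<open>A residue depends only on a punctured neighbourhood, so the artificial value on
    the sparse set \<open>S\<close> is invisible.\<close>
  have h_res: "residue h u = residue (\<lambda>v. \<phi> v * F v) u" for u
    by (rule residue_cong) (use not_S[of u] in \<open>auto simp: h_def elim: eventually_mono\<close>)

  have resP: "residue h u = (\<Sum>\<^sub>\<infinity>n\<in>{1..}. laurent_coeff \<phi> u n / of_nat (fact (n - 1))
      * Dnorm_iter (n - 1) F u) / (2 * pi * \<i>)" if u: "u \<in> P" for u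
  proof -
    obtain N where N: "principal_part \<phi> u N (laurent_coeff \<phi> u)"
      using principal_part_laurent_coeff[OF pole[OF u]] by blast
    have "u \<in> - {w. w - z \<in> L}" using disj u by blast
    then obtain s where s: "s > 0" "ball u s \<subseteq> - {w. w - z \<in> L}"
      using open_zL by (meson open_contains_ball)
    show ?thesis
      unfolding h_res
      by (rule residue_principal_part_mult_Dnorm_iter[OF N s(1) holomorphic_on_subset[OF F s(2)]])
  qed
  have resz: "residue h z = \<phi> z / (2 * pi * \<i>)"
  proof -
    obtain r where r: "r > 0" "ball z r \<subseteq> - P"
      using open_P z by (meson ComplI open_contains_ball)
    show ?thesis
      unfolding h_res F_def
      by (rule residue_appell_lerch[OF M tau r(1) holomorphic_on_subset[OF \<phi> r(2)]])
  qed
  \<comment> \<open>\<open>z\<close> may lie outside the parallelogram; its representative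
    \<open>z'\<close> has the same residue because \<open>h\<close> is periodic.\<close>
  obtain z' where z': "z' \<in> T" "z' - z \<in> L" and unique: "\<And>w. w \<in> T \<Longrightarrow> w - z \<in> L \<Longrightarrow> w = z'"
    using fundamental_domain_fund_par[OF tau, of z0]
    unfolding fundamental_domain_def T_def L_def by metis
  have resz': "residue h z' = residue h z"
  proof -
    have "residue h (z + (z' - z)) = residue h z"
      unfolding residue_translate
      using z'(2) by (simp add: periodic_period_lattice[of h \<tau>, OF per1 per2] L_def)
    then show ?thesis by simp
  qed
  have "S \<inter> T = insert z' (P \<inter> T)"
    unfolding S_def using z' unique by blast
  moreover have "z' \<notin> P \<inter> T" using disj z'(2) by blast
  \<comment> \<open>Needed to split \<open>z'\<close> off the sum, since a sum over an infinite set
    is 0 by default.\<close>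
  moreover have "finite (P \<inter> T)"
  proof -
    have "compact (closure T)" using bounded_fund_par by (simp add: T_def compact_closure)
    then have "finite (closure T \<inter> P)"
      by (rule sparse_in_compact_finite[OF sparse_in_subset[OF Psparse], rotated]) simp
    then show ?thesis
      by (rule finite_subset[rotated]) (use closure_subset in blast)
  qed
  ultimately have "\<phi> z / (2 * pi * \<i>) + (\<Sum>u\<in>P \<inter> T. residue h u) = 0"
    using \<open>(\<Sum>u\<in>S \<inter> T. residue h u) = 0\<close> resz' resz by simp
  moreover have "(\<Sum>u\<in>P \<inter> T. residue h u) = (\<Sum>u\<in>P \<inter> T. \<Sum>\<^sub>\<infinity>n\<in>{1..}. laurent_coeff \<phi> u n / of_nat (fact (n - 1))
      * Dnorm_iter (n - 1) F u) / (2 * pi * \<i>)"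
    unfolding sum_divide_distrib by (intro sum.cong refl resP) auto
  ultimately have "(\<phi> z + (\<Sum>u\<in>P \<inter> T. \<Sum>\<^sub>\<infinity>n\<in>{1..}. laurent_coeff \<phi> u n / of_nat (fact (n - 1))
      * Dnorm_iter (n - 1) F u)) / (2 * pi * \<i>) = 0"
    by (simp only: add_divide_distrib)
  then have "\<phi> z + (\<Sum>u\<in>P \<inter> T. \<Sum>\<^sub>\<infinity>n\<in>{1..}. laurent_coeff \<phi> u n / of_nat (fact (n - 1))
      * Dnorm_iter (n - 1) F u) = 0"
    by simp
  then show ?thesis
    unfolding T_def F_def[abs_def] by (simp only: eq_neg_iff_add_eq_0)
qed

end
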